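(* Let $L>0$ and let $f:\mathbb{R}^d \to \mathbb{R}$ be a convex $L$-smooth function that attains its minimum on $\mathbb{R}^d$, and let $\boldsymbol{x}^* \in \arg\min_{\boldsymbol{x} \in \mathbb{R}^d}f(\boldsymbol{x})$. Let $\boldsymbol{x}_0 \in \mathbb{R}^d$ be arbitrary and let $\boldsymbol{x}_{k+1} = \boldsymbol{x}_k - \frac{1}{L}\nabla f(\boldsymbol{x}_k)$ for all $k \geq 0$. Then $$\mathcal{C}_k = \frac{k}{L}\|\nabla f(\boldsymbol{x}_k)\|^2 + f(\boldsymbol{x}_k)$$ is non-increasing with $k$, and, for all $k \geq 0$, $$\|\nabla f(\boldsymbol{x}_k)\|^2 \leq \frac{2L (f(\boldsymbol{x}_0) - f(\boldsymbol{x}^* ))}{2k + 1}.$$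
   Context: $\|\cdot\| = \sqrt{\langle\cdot,\cdot\rangle}$ is the norm induced by an inner product on $\mathbb{R}^d$, and gradients are taken with respect to that inner product. $f$ is $L$-smooth if it is continuously differentiable and $\|\nabla f(\boldsymbol{x})-\nabla f(\boldsymbol{y})\|\le L\|\boldsymbol{x}-\boldsymbol{y}\|$ for all $\boldsymbol{x},\boldsymbol{y}$. *)

theory Defs
  imports "HOL-Analysis.Analysis"
begin

text \<open>The inner product is an arbitrary one on \<open>\<real>\<^sup>d\<close>, not necessarily the dot product of the
  type class, so the norm and the gradient carry it as a parameter. Differentiability and
  continuity refer to the standard topology, which every inner product on \<open>\<real>\<^sup>d\<close> induces.\<close>

definition is_inner_product :: "(real^'n \<Rightarrow> real^'n \<Rightarrow> real) \<Rightarrow> bool" where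
  "is_inner_product ip \<longleftrightarrow>
     bilinear ip \<and> (\<forall>x y. ip x y = ip y x) \<and> (\<forall>x. x \<noteq> 0 \<longrightarrow> ip x x > 0)"

definition ip_norm :: "(real^'n \<Rightarrow> real^'n \<Rightarrow> real) \<Rightarrow> real^'n \<Rightarrow> real" where
  "ip_norm ip v = sqrt (ip v v)"

text \<open>The vector representing the derivative of \<open>f\<close> at \<open>x\<close> through \<open>ip\<close>; by
  \<open>has_derivative_ip_gradient\<close> below it exists whenever \<open>f\<close> is differentiable at \<open>x\<close>.\<close>

definition ip_gradient ::
    "(real^'n \<Rightarrow> real^'n \<Rightarrow> real) \<Rightarrow> (real^'n \<Rightarrow> real) \<Rightarrow> real^'n \<Rightarrow> real^'n" where
  "ip_gradient ip f x = (THE g. (f has_derivative (\<lambda>h. ip g h)) (at x))"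

definition L_smooth ::
    "(real^'n \<Rightarrow> real^'n \<Rightarrow> real) \<Rightarrow> real \<Rightarrow> (real^'n \<Rightarrow> real) \<Rightarrow> bool" where
  "L_smooth ip L f \<longleftrightarrow>
     (\<forall>x. f differentiable (at x)) \<and>
     continuous_on UNIV (ip_gradient ip f) \<and>
     (\<forall>x y. ip_norm ip (ip_gradient ip f x - ip_gradient ip f y) \<le> L * ip_norm ip (x - y))"

lemma has_derivative_ip_gradient:
  fixes ip :: "real^'n \<Rightarrow> real^'n \<Rightarrow> real" and f :: "real^'n \<Rightarrow> real"
  assumes ip: "is_inner_product ip" and f: "f differentiable (at x)"
  shows "(f has_derivative (\<lambda>h. ip (ip_gradient ip f x) h)) (at x)"
proof -
  have bl: "bilinear ip" and pos: "\<And>v. v \<noteq> 0 \<Longrightarrow> ip v v > 0"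
    using ip by (auto simp: is_inner_product_def)
  have lin_l: "linear (\<lambda>g. ip g h)" and lin_r: "linear (ip g)" for g h
    using bl by (auto simp: bilinear_def)
  define A where "A g = (\<chi> i. ip g (axis i 1))" for g
  have linA: "linear A"
    using linear_add[OF lin_l] linear_scale[OF lin_l]
    by (intro linearI) (auto simp: A_def vec_eq_iff)
  have A: "A g \<bullet> h = ip g h" for g h
  proof -
    have "ip g h = ip g (\<Sum>i\<in>UNIV. h $ i *\<^sub>R axis i 1)"
      using basis_expansion[of h] by (simp add: scalar_mult_eq_scaleR)
    also have "\<dots> = (\<Sum>i\<in>UNIV. h $ i * ip g (axis i 1))"
      by (simp add: linear_sum[OF lin_r] linear_scale[OF lin_r])
    finally show ?thesis by (simp add: A_def inner_vec_def mult.commute)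
  qed
  have "g = 0" if "A g = 0" for g
    using A[of g g] that pos[of g] by (cases "g = 0") auto
  then have "inj A" by (simp add: linear_injective_0[OF linA])
  then have "surj A" using linear_injective_imp_surjective[OF linA] by simp
  obtain D where D: "(f has_derivative D) (at x)"
    using f by (auto simp: differentiable_def)
  have linD: "linear D" using D has_derivative_linear by blast
  obtain g where g: "A g = adjoint D 1" using \<open>surj A\<close> by (metis surjD)
  have "D h = ip g h" for h
    using adjoint_works[OF linD, of h 1] A[of g h] g by (simp add: inner_commute)
  then have Dg: "D = ip g" by auto
  have "g' = g" if "(f has_derivative (\<lambda>h. ip g' h)) (at x)" for g'
  proof -
    have "ip g' = ip g" using has_derivative_unique[OF that D] Dg by simp
    then have "A g' = A g" by (simp add: A_def)
    then show ?thesis using \<open>inj A\<close> by (simp add: inj_eq)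
  qed
  then show ?thesis
    unfolding ip_gradient_def using D Dg by (metis (mono_tags, lifting) theI)
qed

end

theory Submission
  imports Defs
begin

text \<open>Everything rests on the interpolation inequality for convex \<open>L\<close>-smooth functions,
  \<open>f x \<ge> f y + \<langle>\<nabla>f y, x - y\<rangle> + \<parallel>\<nabla>f x - \<nabla>f y\<parallel>\<^sup>2 / (2 L)\<close>
  (lemma \<open>convex_smooth_interpolation\<close>), which in turn combines the tangent inequality of convexity
  with the quadratic upper bound of smoothness (the descent lemma).

  Let \<open>g\<close> and \<open>g'\<close> be the gradients at an iterate \<open>u\<close> and at its successor \<open>v = u - g / L\<close>.
  Since \<open>u - v = g / L\<close>, interpolation at \<open>(u, v)\<close> becomes
  \<open>f u - f v \<ge> (\<parallel>g\<parallel>\<^sup>2 + \<parallel>g'\<parallel>\<^sup>2) / (2 L)\<close>, and adding it to interpolation at \<open>(v, u)\<close> leaves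
  \<open>\<parallel>g'\<parallel>\<^sup>2 \<le> \<langle>g, g'\<rangle>\<close>, hence \<open>\<parallel>g'\<parallel> \<le> \<parallel>g\<parallel>\<close>. The decrease of the potential \<open>C\<close> over step \<open>k\<close> is therefore
  at least \<open>(k + 1 / 2) (\<parallel>g\<parallel>\<^sup>2 - \<parallel>g'\<parallel>\<^sup>2) / L \<ge> 0\<close>.

  For the rate, a gradient step from \<open>x k\<close> cannot go below the minimum, so the descent lemma gives
  \<open>f (x k) - f x_star \<ge> \<parallel>\<nabla>f (x k)\<parallel>\<^sup>2 / (2 L)\<close>. Inserting this into \<open>C k \<le> C 0 = f (x 0)\<close> yields
  \<open>(2 k + 1) / (2 L) \<parallel>\<nabla>f (x k)\<parallel>\<^sup>2 \<le> f (x 0) - f x_star\<close>. Keeping the extra term \<open>1 / (2 L)\<close> is what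
  turns the denominator \<open>2 k\<close> into \<open>2 k + 1\<close>.\<close>

lemma ip_algebra:
  assumes "is_inner_product ip"
  shows "ip (a + b) c = ip a c + ip b c" "ip c (a + b) = ip c a + ip c b"
    "ip (a - b) c = ip a c - ip b c" "ip c (a - b) = ip c a - ip c b"
    "ip (t *\<^sub>R a) c = t * ip a c" "ip c (t *\<^sub>R a) = t * ip c a"
    "ip (- a) c = - ip a c" "ip c (- a) = - ip c a" "ip 0 c = 0" "ip c 0 = 0"
proof -
  have bl: "bilinear ip" using assms by (simp add: is_inner_product_def)
  show "ip (a + b) c = ip a c + ip b c" "ip c (a + b) = ip c a + ip c b"
    "ip (a - b) c = ip a c - ip b c" "ip c (a - b) = ip c a - ip c b"
    "ip (t *\<^sub>R a) c = t * ip a c" "ip c (t *\<^sub>R a) = t * ip c a"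
    "ip (- a) c = - ip a c" "ip c (- a) = - ip c a" "ip 0 c = 0" "ip c 0 = 0"
    using bilinear_ladd[OF bl] bilinear_radd[OF bl] bilinear_lsub[OF bl] bilinear_rsub[OF bl]
      bilinear_lmul[OF bl] bilinear_rmul[OF bl] bilinear_lneg[OF bl] bilinear_rneg[OF bl]
      bilinear_lzero[OF bl] bilinear_rzero[OF bl]
    by auto
qed

lemma ip_commute: "is_inner_product ip \<Longrightarrow> ip a b = ip b a"
  by (simp add: is_inner_product_def)

lemma ip_self_nonneg: "is_inner_product ip \<Longrightarrow> 0 \<le> ip a a"
  by (cases "a = 0") (auto simp: ip_algebra is_inner_product_def less_imp_le)

lemma ip_norm_nonneg: "is_inner_product ip \<Longrightarrow> 0 \<le> ip_norm ip a"
  by (simp add: ip_norm_def ip_self_nonneg)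

lemma ip_norm_sq: "is_inner_product ip \<Longrightarrow> (ip_norm ip a)\<^sup>2 = ip a a"
  by (simp add: ip_norm_def ip_self_nonneg)

lemma ip_norm_scaleR: "is_inner_product ip \<Longrightarrow> ip_norm ip (t *\<^sub>R a) = \<bar>t\<bar> * ip_norm ip a"
  by (simp add: ip_norm_def ip_algebra real_sqrt_mult flip: mult.assoc)

text \<open>The Cauchy--Schwarz inequality: the square of \<open>\<parallel>b\<parallel>\<^sup>2 a - \<langle>a, b\<rangle> b\<close>, a multiple of the part of
  \<open>a\<close> orthogonal to \<open>b\<close>, is nonnegative.\<close>

lemma ip_Cauchy_Schwarz:
  assumes ip: "is_inner_product ip"
  shows "ip a b \<le> ip_norm ip a * ip_norm ip b"
proof (cases "b = 0")
  case True
  then show ?thesis by (simp add: ip_algebra[OF ip] ip_norm_def)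
next
  case False
  then have pos: "ip b b > 0" using ip by (simp add: is_inner_product_def)
  have "0 \<le> ip (ip b b *\<^sub>R a - ip a b *\<^sub>R b) (ip b b *\<^sub>R a - ip a b *\<^sub>R b)"
    by (rule ip_self_nonneg[OF ip])
  also have "\<dots> = ip b b * (ip a a * ip b b - (ip a b)\<^sup>2)"
    by (simp add: ip_algebra[OF ip] ip_commute[OF ip, of b a] algebra_simps power2_eq_square)
  finally have "(ip a b)\<^sup>2 \<le> ip a a * ip b b"
    using pos by (simp add: zero_le_mult_iff)
  then have "sqrt ((ip a b)\<^sup>2) \<le> sqrt (ip a a * ip b b)"
    by (rule real_sqrt_le_mono)
  then show ?thesis
    by (simp add: ip_norm_def real_sqrt_mult)
qed

lemma L_smooth_has_real_derivative_on_line: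
  assumes ip: "is_inner_product ip" and f: "L_smooth ip L f"
  shows "((\<lambda>t. f (z + t *\<^sub>R h)) has_real_derivative
           ip (ip_gradient ip f (z + t *\<^sub>R h)) h) (at t)"
proof -
  have d: "(f has_derivative ip (ip_gradient ip f (z + t *\<^sub>R h))) (at (z + t *\<^sub>R h))"
    using has_derivative_ip_gradient[OF ip] f by (simp add: L_smooth_def)
  have "((\<lambda>t. z + t *\<^sub>R h) has_derivative (\<lambda>s. s *\<^sub>R h)) (at t)"
    by (auto intro!: derivative_eq_intros)
  from has_derivative_compose[OF this d] show ?thesis
    by (rule has_derivative_imp_has_field_derivative) (simp add: ip_algebra[OF ip])
qed

text \<open>The descent lemma. Along the segment from \<open>z\<close> to \<open>z + h\<close>, the difference between \<open>f\<close> and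
  the quadratic model is nonincreasing: its slope at time \<open>t\<close> is
  \<open>\<langle>\<nabla>f (z + t h) - \<nabla>f z, h\<rangle> - L t \<parallel>h\<parallel>\<^sup>2\<close>, which is at most \<open>0\<close> by Cauchy--Schwarz and the
  Lipschitz bound on the gradient.\<close>

lemma L_smooth_descent:
  assumes ip: "is_inner_product ip" and f: "L_smooth ip L f"
  shows "f (z + h) \<le> f z + ip (ip_gradient ip f z) h + L / 2 * ip h h"
proof -
  let ?G = "ip_gradient ip f"
  define \<phi> where "\<phi> t = f (z + t *\<^sub>R h) - t * ip (?G z) h - L / 2 * t\<^sup>2 * ip h h" for t
  have "\<phi> 1 \<le> \<phi> 0"
  proof (rule DERIV_nonpos_imp_nonincreasing[of 0 1 \<phi>])
    fix t :: real
    assume t: "0 \<le> t" "t \<le> 1"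
    have "(\<phi> has_real_derivative
            ip (?G (z + t *\<^sub>R h)) h - ip (?G z) h - L * t * ip h h) (at t)"
      unfolding \<phi>_def
      by (auto intro!: derivative_eq_intros L_smooth_has_real_derivative_on_line[OF ip f])
    moreover have "ip (?G (z + t *\<^sub>R h)) h - ip (?G z) h \<le> L * t * ip h h"
    proof -
      have "ip (?G (z + t *\<^sub>R h)) h - ip (?G z) h = ip (?G (z + t *\<^sub>R h) - ?G z) h"
        by (simp add: ip_algebra[OF ip])
      also have "\<dots> \<le> ip_norm ip (?G (z + t *\<^sub>R h) - ?G z) * ip_norm ip h"
        by (rule ip_Cauchy_Schwarz[OF ip])
      also have "\<dots> \<le> (L * ip_norm ip (z + t *\<^sub>R h - z)) * ip_norm ip h"
        using f by (intro mult_right_mono ip_norm_nonneg[OF ip]) (auto simp only: L_smooth_def)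
      also have "\<dots> = L * t * (ip_norm ip h)\<^sup>2"
        using t by (simp add: ip_norm_scaleR[OF ip] power2_eq_square)
      finally show ?thesis by (simp add: ip_norm_sq[OF ip])
    qed
    ultimately show "\<exists>y. (\<phi> has_real_derivative y) (at t) \<and> y \<le> 0" by fastforce
  qed simp
  then show ?thesis by (simp add: \<phi>_def)
qed

text \<open>The graph of a convex function lies above its tangent planes; restricting to the line through
  \<open>y\<close> and \<open>w\<close> reduces this to the one-dimensional case.\<close>

lemma convex_above_ip_tangent:
  assumes ip: "is_inner_product ip" and f: "L_smooth ip L f" and conv: "convex_on UNIV f"
  shows "f y + ip (ip_gradient ip f y) (w - y) \<le> f w"
proof -
  define \<psi> where "\<psi> t = f (y + t *\<^sub>R (w - y))" for t
  have "convex_on UNIV \<psi>"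
  proof (rule convex_onI)
    fix t a b :: real
    assume t: "0 < t" "t < 1"
    have "y + ((1 - t) *\<^sub>R a + t *\<^sub>R b) *\<^sub>R (w - y)
        = (1 - t) *\<^sub>R (y + a *\<^sub>R (w - y)) + t *\<^sub>R (y + b *\<^sub>R (w - y))"
      by (simp add: algebra_simps)
    then show "\<psi> ((1 - t) *\<^sub>R a + t *\<^sub>R b) \<le> (1 - t) * \<psi> a + t * \<psi> b"
      using convex_onD[OF conv, of t] t by (simp only: \<psi>_def) auto
  qed simp
  moreover have "(\<psi> has_real_derivative ip (ip_gradient ip f y) (w - y)) (at 0)"
    unfolding \<psi>_def
    using L_smooth_has_real_derivative_on_line[OF ip f, of y "w - y" 0] by simp
  ultimately have "\<psi> 1 - \<psi> 0 \<ge> ip (ip_gradient ip f y) (w - y) * (1 - 0)"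
    by (intro convex_on_imp_above_tangent[where A = UNIV]) auto
  then show ?thesis by (simp add: \<psi>_def)
qed

text \<open>The function \<open>\<lambda>w. f w - \<langle>\<nabla>f y, w\<rangle>\<close> is convex, \<open>L\<close>-smooth and minimal at \<open>y\<close>. The gap between
  its value at \<open>x\<close> and its minimum is bounded below by the decrease that the descent lemma guarantees
  for a gradient step from \<open>x\<close>.\<close>

lemma convex_smooth_interpolation:
  assumes ip: "is_inner_product ip" and f: "L_smooth ip L f" and conv: "convex_on UNIV f"
    and L: "L > 0"
  defines "G \<equiv> ip_gradient ip f"
  shows "f y + ip (G y) (x - y) + ip (G x - G y) (G x - G y) / (2 * L) \<le> f x"
proof -
  define d where "d = G x - G y"
  have Gx: "G x = G y + d" by (simp add: d_def)
  \<comment> \<open>The gradient step from \<open>x\<close> for \<open>\<lambda>w. f w - \<langle>\<nabla>f y, w\<rangle>\<close>, whose gradient there is \<open>d\<close>.\<close>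
  define h where "h = (- (1 / L)) *\<^sub>R d"
  have "f y + ip (G y) (x + h - y) \<le> f (x + h)"
    unfolding G_def by (rule convex_above_ip_tangent[OF ip f conv])
  also have "\<dots> \<le> f x + ip (G x) h + L / 2 * ip h h"
    unfolding G_def by (rule L_smooth_descent[OF ip f])
  finally have "f y + ip (G y) (x - y) \<le> f x + ip d h + L / 2 * ip h h"
    by (simp add: Gx ip_algebra[OF ip])
  moreover have "ip d h + L / 2 * ip h h = - (ip d d / (2 * L))"
    using L by (simp add: h_def ip_algebra[OF ip] field_simps)
  ultimately show ?thesis by (simp add: d_def)
qed

text \<open>Because \<open>G u = L (u - v)\<close>, the linear terms of interpolation are inner products of gradients,
  so both parts are statements about \<open>\<parallel>G u\<parallel>\<^sup>2\<close>, \<open>\<parallel>G v\<parallel>\<^sup>2\<close> and \<open>\<langle>G u, G v\<rangle>\<close>. In the first, the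
  mixed products cancel, which gives a symmetric bound; in the second, the sum of the two
  interpolation inequalities gives \<open>\<parallel>G v\<parallel>\<^sup>2 \<le> \<langle>G u, G v\<rangle>\<close>.\<close>

lemma gradient_step:
  assumes ip: "is_inner_product ip" and f: "L_smooth ip L f" and conv: "convex_on UNIV f"
    and L: "L > 0"
  defines "G \<equiv> ip_gradient ip f"
  assumes v: "v = u - (1 / L) *\<^sub>R G u"
  shows gradient_step_decrease: "f v + (ip (G u) (G u) + ip (G v) (G v)) / (2 * L) \<le> f u"
    and gradient_step_gradient_le: "ip (G v) (G v) \<le> ip (G u) (G u)"
proof -
  define a b c where "a = ip (G u) (G u)" and "b = ip (G v) (G v)" and "c = ip (G u) (G v)"
  have c': "ip (G v) (G u) = c" by (simp add: c_def ip_commute[OF ip])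
  have uv: "u - v = (1 / L) *\<^sub>R G u" and vu: "v - u = (- (1 / L)) *\<^sub>R G u"
    by (simp_all add: v)
  have sq: "ip (G u - G v) (G u - G v) = a + b - 2 * c" "ip (G v - G u) (G v - G u) = a + b - 2 * c"
    by (simp_all add: ip_algebra[OF ip] c') (simp_all add: a_def b_def c_def)
  have "f v + ip (G v) (u - v) + ip (G u - G v) (G u - G v) / (2 * L) \<le> f u"
    unfolding G_def by (rule convex_smooth_interpolation[OF ip f conv L])
  then have "f v + c / L + (a + b - 2 * c) / (2 * L) \<le> f u"
    unfolding uv sq by (simp add: ip_algebra[OF ip] c')
  moreover have "c / L + (a + b - 2 * c) / (2 * L) = (a + b) / (2 * L)"
    using L by (simp add: field_simps)
  ultimately have decrease: "f v + (a + b) / (2 * L) \<le> f u" by simp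
  then show "f v + (ip (G u) (G u) + ip (G v) (G v)) / (2 * L) \<le> f u"
    by (simp add: a_def b_def)
  have "f u + ip (G u) (v - u) + ip (G v - G u) (G v - G u) / (2 * L) \<le> f v"
    unfolding G_def by (rule convex_smooth_interpolation[OF ip f conv L])
  then have "f u - a / L + (a + b - 2 * c) / (2 * L) \<le> f v"
    unfolding vu sq by (simp add: ip_algebra[OF ip] a_def)
  moreover have "(a + b) / (2 * L) - a / L + (a + b - 2 * c) / (2 * L) = (b - c) / L"
    using L by (simp add: field_simps)
  ultimately have "(b - c) / L \<le> 0" using decrease by linarith
  then have "b \<le> c" using L by (simp add: divide_le_0_iff)
  moreover have "0 \<le> a + b - 2 * c"
    using ip_self_nonneg[OF ip, of "G u - G v"] by (simp only: sq)
  ultimately show "ip (G v) (G v) \<le> ip (G u) (G u)"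
    by (simp add: a_def b_def)
qed

theorem lemma2p1:
  fixes ip :: "real^'n \<Rightarrow> real^'n \<Rightarrow> real"
    and f :: "real^'n \<Rightarrow> real"
    and L :: real
    and x_star :: "real^'n"
    and x :: "nat \<Rightarrow> real^'n"
  assumes "is_inner_product ip"
    and "L > 0"
    and "convex_on UNIV f"
    and "L_smooth ip L f"
    and "is_arg_min f (\<lambda>_. True) x_star"
    and "\<And>k. x (Suc k) = x k - (1 / L) *\<^sub>R ip_gradient ip f (x k)"
  shows "antimono (\<lambda>k. real k / L * (ip_norm ip (ip_gradient ip f (x k)))\<^sup>2 + f (x k))
    \<and> (\<forall>k. (ip_norm ip (ip_gradient ip f (x k)))\<^sup>2
              \<le> 2 * L * (f (x 0) - f x_star) / (2 * real k + 1))"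
proof -
  note ip = assms(1) and L = assms(2) and conv = assms(3) and f = assms(4) and step = assms(6)
  define n where "n k = (ip_norm ip (ip_gradient ip f (x k)))\<^sup>2" for k
  have n: "n k = ip (ip_gradient ip f (x k)) (ip_gradient ip f (x k))" for k
    by (simp add: n_def ip_norm_sq[OF ip])
  define C where "C k = real k / L * n k + f (x k)" for k
  have "C (Suc k) \<le> C k" for k
  proof -
    have "f (x (Suc k)) + (n k + n (Suc k)) / (2 * L) \<le> f (x k)"
      unfolding n by (rule gradient_step_decrease[OF ip f conv L step])
    moreover have "C k - C (Suc k) - (real k + 1 / 2) / L * (n k - n (Suc k))
        = f (x k) - (f (x (Suc k)) + (n k + n (Suc k)) / (2 * L))"
      using L by (simp add: C_def field_simps)
    moreover have "n (Suc k) \<le> n k"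
      unfolding n by (rule gradient_step_gradient_le[OF ip f conv L step])
    then have "(real k + 1 / 2) / L * (n k - n (Suc k)) \<ge> 0"
      using L by (intro mult_nonneg_nonneg) auto
    ultimately show ?thesis by linarith
  qed
  then have anti: "antimono C" by (simp add: antimono_iff_le_Suc)
  have "n k \<le> 2 * L * (f (x 0) - f x_star) / (2 * real k + 1)" for k
  proof -
    let ?g = "ip_gradient ip f (x k)"
    have "f x_star \<le> f (x k + (- (1 / L)) *\<^sub>R ?g)"
      using assms(5) by (simp add: is_arg_min_linorder)
    also have "\<dots> \<le> f (x k) + ip ?g ((- (1 / L)) *\<^sub>R ?g)
        + L / 2 * ip ((- (1 / L)) *\<^sub>R ?g) ((- (1 / L)) *\<^sub>R ?g)"
      by (rule L_smooth_descent[OF ip f])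
    also have "\<dots> = f (x k) - n k / (2 * L)"
      using L unfolding n ip_algebra[OF ip] by (simp add: field_simps)
    finally have "f x_star + n k / (2 * L) \<le> f (x k)" by simp
    moreover have "real k / L * n k + f (x k) \<le> f (x 0)"
      using antimonoD[OF anti, of 0 k] by (simp add: C_def)
    ultimately have "real k / L * n k + n k / (2 * L) \<le> f (x 0) - f x_star" by simp
    then show ?thesis using L by (simp add: field_simps)
  qed
  with anti show ?thesis unfolding C_def n_def by blast
qed

end
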